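(* Let $g:[0,1]\to\mathbb{R}^+$ be an integrable function, let $p>1$, and assume that $\int_0^1 g=f$. Then for any $q$ such that $1\le q\le p$ the following inequality is true: $$\int_0^1\Big(\frac1t\int_0^t g\Big)^p dt\;<\;\Big(\frac{p}{p-1}\Big)^q\int_0^1\Big(\frac1t\int_0^t g\Big)^{p-q}g^q(t)\,dt-\frac{q}{p-1}f^p .$$ Moreover, this inequality is sharp in the sense that the constant $\big(\frac{p}{p-1}\big)^q$ cannot be decreased, while the constant $\frac{q}{p-1}$ cannot be increased for any fixed $f$. That is: (i) for every $K<\big(\frac{p}{p-1}\big)^q$ the inequality obtained by replacing $\big(\frac{p}{p-1}\big)^q$ by $K$ fails for some integrable $g:[0,1]\to\mathbb{R}^+$ (with $f=\int_0^1 g$); (ii) for any fixed $f>0$ and every $C>\frac{q}{p-1}$, the inequality obtained by replacing $\frac{q}{p-1}$ by $C$ fails for some integrable $g:[0,1]\to\mathbb{R}^+$ with $\int_0^1 g=f$.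
   Context: Here $\mathbb{R}^+$ denotes the non-negative real numbers, and $\frac1t\int_0^t g$ is the average of $g$ over $(0,t]$.
   Formalization: The strict inequality fails for q=1 (e.g. g=1 gives equality), for f=0, and when the left side is infinite; it is proved as ≤ in general and as strict < when q>1, f>0 and the left-hand integral is finite; failure in (i) and (ii) means failure even of ≤. *)

theory Defs
  imports "HOL-Analysis.Analysis"
begin

text \<open>Only the values on \<open>[0,1]\<close> matter. Integrability is with respect to Lebesgue measure
  on the Lebesgue-measurable sets, so \<open>g\<close> need not be Borel measurable.\<close>

definition nonneg_integrable_01 :: "(real \<Rightarrow> real) \<Rightarrow> bool" where
  "nonneg_integrable_01 g \<longleftrightarrow> (\<forall>t\<in>{0..1}. 0 \<le> g t) \<and> set_integrable lebesgue {0..1} g"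

definition avg :: "(real \<Rightarrow> real) \<Rightarrow> real \<Rightarrow> real" where
  "avg g t = (1 / t) * (LINT s:{0..t}|lebesgue. g s)"

text \<open>Integrability of \<open>g\<close> does not make the two integrals below finite, so they are taken in
  \<open>[0,\<infinity>]\<close>, and the inequality is read in the extended reals; the subtracted term is always
  finite. The convention \<open>0 powr a = 0\<close>, also for \<open>a = 0\<close>, is harmless: if \<open>avg g t = 0\<close> with
  \<open>t > 0\<close>, then \<open>g\<close> vanishes almost everywhere on \<open>[0,t]\<close>. Likewise \<open>1 / 0 = 0\<close>
  in \<open>avg g 0\<close> affects a single point.\<close>

definition hardy_lhs :: "real \<Rightarrow> (real \<Rightarrow> real) \<Rightarrow> ereal" where
  "hardy_lhs p g = enn2ereal (\<integral>\<^sup>+t\<in>{0..1}. ennreal (avg g t powr p) \<partial>lebesgue)"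

definition hardy_rhs :: "real \<Rightarrow> real \<Rightarrow> real \<Rightarrow> real \<Rightarrow> real \<Rightarrow> (real \<Rightarrow> real) \<Rightarrow> ereal" where
  "hardy_rhs K C p q f g =
     ereal K * enn2ereal (\<integral>\<^sup>+t\<in>{0..1}. ennreal (avg g t powr (p - q) * g t powr q) \<partial>lebesgue)
     - ereal (C * f powr p)"

text \<open>For \<open>K = (p / (p - 1)) powr q\<close> and \<open>C = q / (p - 1)\<close> the inequality
  \<open>hardy_lhs p g < hardy_rhs K C p q f g\<close> cannot be strict throughout: integration by parts
  always gives equality for \<open>q = 1\<close>; if \<open>f = 0\<close>, both sides are \<open>0\<close>; and if the left-hand side is
  \<open>\<infinity>\<close>, so is the right-hand side. Failure of an inequality is correspondingly taken as failure
  of the non-strict form, so that none of these degenerate cases is a counterexample.\<close>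

end

theory Submission
  imports Defs
begin

text \<open>
  Write \<open>A t = avg g t\<close> and \<open>\<lambda> = p / (p - 1)\<close>. Since \<open>A' = (g - A) / t\<close> almost everywhere,
  \<open>(t A\<^sup>p)' = k\<close> for \<open>k = p A\<^bsup>p-1\<^esup> g - (p - 1) A\<^sup>p\<close>. Bernoulli's inequality \<open>z\<^sup>q \<ge> 1 + q (z - 1)\<close> at
  \<open>z = \<lambda> g / A\<close>, multiplied by \<open>A\<^sup>p\<close>, says \<open>\<lambda>\<^sup>q A\<^bsup>p-q\<^esup> g\<^sup>q \<ge> A\<^sup>p + q / (p - 1) k\<close>, and integrating over
  \<open>[a,1]\<close> gives the inequality up to the boundary term \<open>a A(a)\<^sup>p\<close>. If \<open>\<integral> A\<^sup>p\<close> is finite this term is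
  arbitrarily small for suitable \<open>a\<close>, because \<open>1 / t\<close> is not integrable. Equality for \<open>q > 1\<close>
  forces \<open>k = 0\<close>, so \<open>t A\<^sup>p\<close> is constant, which contradicts this unless \<open>f = 0\<close>. Sharpness of both
  constants is seen on \<open>g t = f (1 - \<alpha>) t\<^bsup>-\<alpha>\<^esup>\<close> as \<open>\<alpha>\<close> increases to \<open>1 / p\<close>.
\<close>

section \<open>A chain rule for indefinite integrals\<close>

text \<open>On short intervals the increment of \<phi> along the graph of \<open>G\<close> and the
  integral of the claimed derivative are both close to the same linearisation; bisection carries the
  estimate to \<open>{a..b}\<close>. The derivative is taken only within the product with the range
  of \<open>G\<close>, because \<phi> will involve a power of \<open>G t\<close> at points where
  \<open>G t = 0\<close>.\<close>

lemma has_integral_chain_rule_indefinite: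
  fixes g G \<phi>\<^sub>1 \<phi>\<^sub>2 :: "real \<Rightarrow> real" and \<phi> :: "real \<times> real \<Rightarrow> real"
  assumes "a \<le> b" and g: "g absolutely_integrable_on {a..b}"
    and g0: "\<And>t. t \<in> {a..b} \<Longrightarrow> 0 \<le> g t"
    and G: "\<And>t. t \<in> {a..b} \<Longrightarrow> G t = G a + integral {a..t} g"
    and der: "\<And>t. t \<in> {a..b} \<Longrightarrow>
      (\<phi> has_derivative (\<lambda>(u, v). \<phi>\<^sub>1 t * u + \<phi>\<^sub>2 t * v)) (at (t, G t) within {a..b} \<times> G ` {a..b})"
    and c1: "continuous_on {a..b} \<phi>\<^sub>1" and c2: "continuous_on {a..b} \<phi>\<^sub>2"
  shows "((\<lambda>t. \<phi>\<^sub>1 t + \<phi>\<^sub>2 t * g t) has_integral \<phi> (b, G b) - \<phi> (a, G a)) {a..b}"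
proof -
  define k where "k = (\<lambda>t. \<phi>\<^sub>1 t + \<phi>\<^sub>2 t * g t)"
  \<comment> \<open>\<open>G\<close> need not be differentiable everywhere; bounding the local error by increments of the
    monotone function \<open>W\<close> instead of increments of \<open>t\<close> avoids any differentiation theorem.\<close>
  define W where "W = (\<lambda>t. t + G t)"
  have gi: "g integrable_on {a..b}"
    using g by (rule set_lebesgue_integral_eq_integral)
  have Gc: "continuous_on {a..b} G"
  proof -
    have "continuous_on {a..b} (\<lambda>t. G a + integral {a..t} g)"
      by (intro continuous_intros indefinite_integral_continuous_1 gi)
    then show ?thesis
      by (rule continuous_on_eq) (metis G)
  qed
  have Gd: "G v - G u = integral {u..v} g" if "a \<le> u" "u \<le> v" "v \<le> b" for u v
    using Henstock_Kurzweil_Integration.integral_combine[OF \<open>a \<le> u\<close> \<open>u \<le> v\<close>, of g]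
      integrable_on_subinterval[OF gi, of a v] G[of u] G[of v] that by auto
  have Gmono: "G u \<le> G v" if "a \<le> u" "u \<le> v" "v \<le> b" for u v
    using Gd[OF that] integral_nonneg[OF integrable_on_subinterval[OF gi], of u v] g0 that by force
  have "(\<lambda>t. \<phi>\<^sub>2 t * g t) absolutely_integrable_on {a..b}"
    by (intro absolutely_integrable_bounded_measurable_product_real g
        continuous_imp_measurable_on_sets_lebesgue c2 compact_imp_bounded
        compact_continuous_image) auto
  then have ki: "k integrable_on {a..b}"
    unfolding k_def
    by (intro integrable_add integrable_continuous_interval c1 set_lebesgue_integral_eq_integral)
  have bound: "\<bar>\<phi> (b, G b) - \<phi> (a, G a) - integral {a..b} k\<bar> \<le> 2 * \<eta> * (W b - W a)" if "\<eta> > 0" for \<eta>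
  proof -
    define P where "P = (\<lambda>u v. a \<le> u \<and> u \<le> v \<and> v \<le> b \<longrightarrow>
      \<bar>\<phi> (v, G v) - \<phi> (u, G u) - integral {u..v} k\<bar> \<le> 2 * \<eta> * (W v - W u))"
    \<comment> \<open>\<open>P\<close> passes to the union of adjacent intervals, so bisection
      reduces it to short intervals containing a given point.\<close>
    have "P a b"
      using \<open>a \<le> b\<close>
    proof (induction rule: Bolzano)
      case (trans u v w)
      have "integral {u..v} k + integral {v..w} k = integral {u..w} k" if "a \<le> u" "w \<le> b"
        using that trans(3,4) by (intro Henstock_Kurzweil_Integration.integral_combine integrable_on_subinterval[OF ki]) auto
      with trans show ?case
        unfolding P_def by (auto simp: algebra_simps abs_le_iff)
    next
      case (local x)
      then have x: "x \<in> {a..b}" by auto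
      obtain d1 where "d1 > 0" and d1: "\<And>y. y \<in> {a..b} \<Longrightarrow> \<bar>y - x\<bar> < d1 \<Longrightarrow> \<bar>\<phi>\<^sub>1 y - \<phi>\<^sub>1 x\<bar> < \<eta>"
        using c1 x \<open>\<eta> > 0\<close> unfolding continuous_on_iff dist_real_def by metis
      obtain d2 where "d2 > 0" and d2: "\<And>y. y \<in> {a..b} \<Longrightarrow> \<bar>y - x\<bar> < d2 \<Longrightarrow> \<bar>\<phi>\<^sub>2 y - \<phi>\<^sub>2 x\<bar> < \<eta>"
        using c2 x \<open>\<eta> > 0\<close> unfolding continuous_on_iff dist_real_def by metis
      obtain d3 where "d3 > 0" and d3: "\<And>z. z \<in> {a..b} \<times> G ` {a..b} \<Longrightarrow> norm (z - (x, G x)) < d3 \<Longrightarrow>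
          norm (\<phi> z - \<phi> (x, G x) - (\<lambda>(u, v). \<phi>\<^sub>1 x * u + \<phi>\<^sub>2 x * v) (z - (x, G x)))
            \<le> \<eta> * norm (z - (x, G x))"
        using der[OF x] \<open>\<eta> > 0\<close> unfolding has_derivative_within_alt by blast
      obtain d4 where "d4 > 0" and d4: "\<And>y. y \<in> {a..b} \<Longrightarrow> \<bar>y - x\<bar> < d4 \<Longrightarrow> \<bar>G y - G x\<bar> < d3 / 2"
        using Gc x \<open>d3 > 0\<close> unfolding continuous_on_iff dist_real_def by (metis half_gt_zero)
      define d where "d = Min {d1, d2, d3 / 2, d4}"
      have d: "d > 0" "d \<le> d1" "d \<le> d2" "d \<le> d3 / 2" "d \<le> d4"
        using \<open>d1 > 0\<close> \<open>d2 > 0\<close> \<open>d3 > 0\<close> \<open>d4 > 0\<close> by (auto simp: d_def)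
      have lin: "\<bar>\<phi> (y, G y) - \<phi> (x, G x) - (\<phi>\<^sub>1 x * (y - x) + \<phi>\<^sub>2 x * (G y - G x))\<bar> \<le> \<eta> * \<bar>W y - W x\<bar>"
        if y: "y \<in> {a..b}" "\<bar>y - x\<bar> < d" for y
      proof -
        have n: "norm ((y, G y) - (x, G x)) \<le> \<bar>y - x\<bar> + \<bar>G y - G x\<bar>"
          using norm_Pair_le[of "y - x" "G y - G x"] by simp
        have "\<bar>y - x\<bar> + \<bar>G y - G x\<bar> = \<bar>W y - W x\<bar>"
          using Gmono[of x y] Gmono[of y x] x y by (cases "x \<le> y") (auto simp: W_def)
        with n have n': "norm ((y, G y) - (x, G x)) \<le> \<bar>W y - W x\<bar>" by simp
        have "norm ((y, G y) - (x, G x)) < d3"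
          using n d4[of y] y d by linarith
        from d3[OF _ this] y
        have "\<bar>\<phi> (y, G y) - \<phi> (x, G x) - (\<phi>\<^sub>1 x * (y - x) + \<phi>\<^sub>2 x * (G y - G x))\<bar>
            \<le> \<eta> * norm ((y, G y) - (x, G x))" by auto
        also have "\<dots> \<le> \<eta> * \<bar>W y - W x\<bar>"
          using n' \<open>\<eta> > 0\<close> by simp
        finally show ?thesis .
      qed
      have "P u v" if uv: "u \<le> x" "x \<le> v" "v - u < d" for u v
        unfolding P_def
      proof (intro impI)
        assume ab: "a \<le> u \<and> u \<le> v \<and> v \<le> b"
        have gi': "g integrable_on {u..v}" and ki': "k integrable_on {u..v}"
          using gi ki ab by (auto intro: integrable_on_subinterval)
        \<comment> \<open>First \<open>\<eta>\<close>: freezing both coefficients at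
          \<open>x\<close> changes the integrand by at most \<open>\<eta> * (1 + g r)\<close>, which
          integrates to \<open>\<eta> * (W v - W u)\<close>.\<close>
        have I: "((\<lambda>r. k r - (\<phi>\<^sub>1 x + \<phi>\<^sub>2 x * g r)) has_integral
            integral {u..v} k - (\<phi>\<^sub>1 x * (v - u) + \<phi>\<^sub>2 x * (G v - G u))) {u..v}"
          using ab Gd[of u v] has_integral_const_real[of "\<phi>\<^sub>1 x" u v]
          by (intro has_integral_diff has_integral_add has_integral_mult_right)
             (auto intro: integrable_integral gi' ki' simp: mult.commute)
        have J: "((\<lambda>r. \<eta> * (1 + g r)) has_integral \<eta> * (W v - W u)) {u..v}"
        proof -
          have "((\<lambda>r. \<eta> * (1 + g r)) has_integral \<eta> * ((v - u) + integral {u..v} g)) {u..v}"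
            using has_integral_const_real[of "1::real" u v] ab
            by (intro has_integral_mult_right has_integral_add integrable_integral gi') auto
          then show ?thesis
            using Gd[of u v] ab by (simp add: W_def algebra_simps)
        qed
        have le: "norm (k r - (\<phi>\<^sub>1 x + \<phi>\<^sub>2 x * g r)) \<le> \<eta> * (1 + g r)" if r: "r \<in> {u..v}" for r
        proof -
          have rb: "r \<in> {a..b}" "\<bar>r - x\<bar> < d1" "\<bar>r - x\<bar> < d2" "0 \<le> g r"
            using r uv ab d g0[of r] by auto
          have "k r - (\<phi>\<^sub>1 x + \<phi>\<^sub>2 x * g r) = (\<phi>\<^sub>1 r - \<phi>\<^sub>1 x) + (\<phi>\<^sub>2 r - \<phi>\<^sub>2 x) * g r"
            by (simp add: k_def algebra_simps)
          also have "\<bar>\<dots>\<bar> \<le> \<bar>\<phi>\<^sub>1 r - \<phi>\<^sub>1 x\<bar> + \<bar>\<phi>\<^sub>2 r - \<phi>\<^sub>2 x\<bar> * \<bar>g r\<bar>"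
            using abs_triangle_ineq abs_mult by metis
          also have "\<dots> \<le> \<eta> + \<eta> * \<bar>g r\<bar>"
            using d1[of r] d2[of r] rb by (intro add_mono mult_right_mono) auto
          finally show ?thesis using rb by (simp add: algebra_simps)
        qed
        have "\<bar>integral {u..v} k - (\<phi>\<^sub>1 x * (v - u) + \<phi>\<^sub>2 x * (G v - G u))\<bar> \<le> \<eta> * (W v - W u)"
          using integral_norm_bound_integral[OF has_integral_integrable[OF I] has_integral_integrable[OF J] le]
          unfolding integral_unique[OF I] integral_unique[OF J] real_norm_def .
        \<comment> \<open>Second \<open>\<eta>\<close>: linearise from \<open>x\<close> to each
          endpoint. As \<open>x\<close> lies between them and \<open>W\<close> is monotone, the two
          errors add up to the increment of \<open>W\<close> over \<open>{u..v}\<close>.\<close>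
        moreover have "\<bar>\<phi> (v, G v) - \<phi> (u, G u) - (\<phi>\<^sub>1 x * (v - u) + \<phi>\<^sub>2 x * (G v - G u))\<bar> \<le> \<eta> * (W v - W u)"
        proof -
          have "\<bar>W v - W x\<bar> = W v - W x" "\<bar>W u - W x\<bar> = W x - W u"
            using Gmono[of x v] Gmono[of u x] uv ab by (auto simp: W_def)
          with lin[of u] lin[of v] uv ab show ?thesis
            by (auto simp: abs_le_iff algebra_simps)
        qed
        ultimately show "\<bar>\<phi> (v, G v) - \<phi> (u, G u) - integral {u..v} k\<bar> \<le> 2 * \<eta> * (W v - W u)"
          by linarith
      qed
      then show ?case
        using \<open>d > 0\<close> by blast
    qed
    then show ?thesis using \<open>a \<le> b\<close> by (simp add: P_def)
  qed
  have W: "W a \<le> W b"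
    using Gmono[of a b] \<open>a \<le> b\<close> by (simp add: W_def)
  have "\<bar>\<phi> (b, G b) - \<phi> (a, G a) - integral {a..b} k\<bar> \<le> 0"
  proof (rule field_le_epsilon)
    fix e :: real assume "e > 0"
    \<comment> \<open>The added 1 keeps the divisor positive when \<open>W a = W b\<close>.\<close>
    have "2 * (e / (2 * (W b - W a + 1))) * (W b - W a) = e * ((W b - W a) / (W b - W a + 1))"
      using W by (simp add: field_simps)
    also have "\<dots> \<le> e * 1"
      using W \<open>e > 0\<close> by (intro mult_left_mono) auto
    finally show "\<bar>\<phi> (b, G b) - \<phi> (a, G a) - integral {a..b} k\<bar> \<le> 0 + e"
      using bound[of "e / (2 * (W b - W a + 1))"] W \<open>e > 0\<close> by auto
  qed
  then have "integral {a..b} k = \<phi> (b, G b) - \<phi> (a, G a)" by simp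
  then show ?thesis
    using integrable_integral[OF ki] unfolding k_def by simp
qed

section \<open>Real powers: one-sided derivative and Bernoulli's inequality\<close>

text \<open>The point 0 is included because the average of \<open>g\<close> may vanish on an initial
  interval. There the difference quotient is \<open>z powr (p - 1)\<close>, which tends to 0 as
  \<open>p > 1\<close>.\<close>

lemma has_real_derivative_powr_nonneg:
  fixes y p :: real
  assumes "1 < p" "0 \<le> y"
  shows "((\<lambda>y. y powr p) has_real_derivative p * y powr (p - 1)) (at y within {0..})"
proof (cases "y = 0")
  case True
  have "((\<lambda>z::real. z powr (p - 1)) \<longlongrightarrow> 0 powr (p - 1)) (at 0 within {0..})"
    using assms by (intro tendsto_powr' tendsto_intros) (auto simp: eventually_at_filter)
  then have "((\<lambda>z::real. z powr (p - 1)) \<longlongrightarrow> 0) (at 0 within {0..})"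
    by simp
  moreover have "\<forall>\<^sub>F z::real in at 0 within {0..}. z powr (p - 1) = z powr p / z"
    by (auto simp: eventually_at_filter powr_diff)
  ultimately have "((\<lambda>z::real. z powr p / z) \<longlongrightarrow> 0) (at 0 within {0..})"
    by (rule Lim_transform_eventually)
  then show ?thesis
    using True by (simp add: has_field_derivative_iff)
next
  case False
  then show ?thesis
    using assms has_real_derivative_powr[of y p] by (auto intro: has_field_derivative_at_within)
qed

text \<open>By the mean value theorem between \<open>x\<close> and 1: the slope
  \<open>q * z powr (q - 1)\<close> is below \<open>q\<close> for \<open>z < 1\<close> and above it
  for \<open>z > 1\<close>. Strictness is what settles the case of equality later.\<close>

lemma one_add_mult_less_powr:
  fixes x q :: real
  assumes "1 < q" "0 \<le> x" "x \<noteq> 1"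
  shows "1 + q * (x - 1) < x powr q"
proof (cases "x = 0")
  case True
  then show ?thesis using assms by simp
next
  case False
  then have "0 < x" using assms by simp
  have der: "((\<lambda>x. x powr q) has_real_derivative q * z powr (q - 1)) (at z)" if "0 < z" for z
    using that by (rule has_real_derivative_powr)
  show ?thesis
  proof (cases "x < 1")
    case True
    then obtain z where z: "x < z" "z < 1" "1 powr q - x powr q = (1 - x) * (q * z powr (q - 1))"
      using MVT2[of x 1 "\<lambda>x. x powr q" "\<lambda>z. q * z powr (q - 1)"] der \<open>0 < x\<close> by force
    have "z powr (q - 1) < 1"
      using powr_less_mono2[of "q - 1" z 1] z \<open>0 < x\<close> assms by simp
    then have "(1 - x) * (q * z powr (q - 1)) < (1 - x) * (q * 1)"
      using True assms by (intro mult_strict_left_mono) auto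
    with z show ?thesis by (simp add: algebra_simps)
  next
    case False
    then have "1 < x" using assms by simp
    then obtain z where z: "1 < z" "z < x" "x powr q - 1 powr q = (x - 1) * (q * z powr (q - 1))"
      using MVT2[of 1 x "\<lambda>x. x powr q" "\<lambda>z. q * z powr (q - 1)"] der by force
    have "1 < z powr (q - 1)"
      using powr_less_mono2[of "q - 1" 1 z] z assms by simp
    then have "(x - 1) * (q * 1) < (x - 1) * (q * z powr (q - 1))"
      using \<open>1 < x\<close> assms by (intro mult_strict_left_mono) auto
    with z show ?thesis by (simp add: algebra_simps)
  qed
qed

section \<open>Integrals in \<open>[0,\<infinity>]\<close> and gauge integrals\<close>

text \<open>Leads from the extended-valued integrals of the statement to the gauge integral, where
  the calculus takes place.\<close>

lemma set_nn_integral_lebesgue_eq_integral: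
  fixes f :: "'a::euclidean_space \<Rightarrow> real"
  assumes "f \<in> borel_measurable (lebesgue_on S)" "S \<in> sets lebesgue"
    and "\<And>x. x \<in> S \<Longrightarrow> 0 \<le> f x" and "(\<integral>\<^sup>+x\<in>S. ennreal (f x) \<partial>lebesgue) < \<infinity>"
  shows "f absolutely_integrable_on S"
    and "(\<integral>\<^sup>+x\<in>S. ennreal (f x) \<partial>lebesgue) = ennreal (integral S f)"
proof -
  have eq: "(\<integral>\<^sup>+x\<in>S. ennreal (f x) \<partial>lebesgue) = (\<integral>\<^sup>+x. ennreal (f x) \<partial>lebesgue_on S)"
    using assms(2) by (simp add: nn_integral_restrict_space)
  have ae: "AE x in lebesgue_on S. 0 \<le> f x"
    using assms(3) by (auto intro: AE_I2)
  have int: "integrable (lebesgue_on S) f"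
    using assms eq by (intro integrableI_nonneg ae) auto
  show "f absolutely_integrable_on S"
    using int assms(2) by (simp add: integrable_restrict_space set_integrable_def)
  show "(\<integral>\<^sup>+x\<in>S. ennreal (f x) \<partial>lebesgue) = ennreal (integral S f)"
    unfolding eq nn_integral_eq_integral[OF int ae]
    using int assms(2) by (simp add: lebesgue_integral_eq_integral)
qed

lemma has_integral_imp_set_nn_integral_lebesgue:
  fixes f :: "'a::euclidean_space \<Rightarrow> real"
  assumes "(f has_integral i) S" "\<And>x. x \<in> S \<Longrightarrow> 0 \<le> f x"
  shows "(\<integral>\<^sup>+x\<in>S. ennreal (f x) \<partial>lebesgue) = ennreal i"
  using nn_integral_has_integral_lebesgue'[OF assms(2,1)] by (simp add: nn_integral_completion)

lemma measurable_one_divide: "(\<lambda>t::real. 1 / t) \<in> borel_measurable (lebesgue_on S)"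
proof (rule measurable_restrict_space1, rule measurable_completion)
  show "(\<lambda>t::real. 1 / t) \<in> borel_measurable lborel"
    by measurable
qed

lemma not_integrable_inverse_from_0:
  fixes b :: real
  assumes "0 < b"
  shows "\<not> (\<lambda>t. 1 / t) integrable_on {0..b}"
proof
  assume int: "(\<lambda>t. 1 / t) integrable_on {0..b}"
  define M where "M = integral {0..b} (\<lambda>t. 1 / t)"
  \<comment> \<open>Chosen so that \<open>ln b - ln \<epsilon> = \<bar>M\<bar> + 1\<close>, which
    exceeds the supposed total \<open>M\<close>.\<close>
  define \<epsilon> where "\<epsilon> = b * exp (- (\<bar>M\<bar> + 1))"
  have "exp (- (\<bar>M\<bar> + 1)) \<le> exp 0" by (subst exp_le_cancel_iff) auto
  then have \<epsilon>: "0 < \<epsilon>" "\<epsilon> \<le> b"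
    using assms by (auto simp: \<epsilon>_def mult_le_cancel_left1)
  have "((\<lambda>t. 1 / t) has_integral ln b - ln \<epsilon>) {\<epsilon>..b}"
    using \<epsilon> by (intro fundamental_theorem_of_calculus)
      (auto intro!: derivative_eq_intros simp: has_real_derivative_iff_has_vector_derivative[symmetric] divide_simps)
  moreover have "ln b - ln \<epsilon> = \<bar>M\<bar> + 1"
    using assms by (simp add: \<epsilon>_def ln_mult)
  ultimately have "integral {\<epsilon>..b} (\<lambda>t. 1 / t) = \<bar>M\<bar> + 1"
    by (metis integral_unique)
  moreover have "integral {\<epsilon>..b} (\<lambda>t. 1 / t) \<le> M"
    unfolding M_def using \<epsilon> int
    by (intro integral_subset_le integrable_on_subinterval[OF int]) auto
  ultimately show False by linarith
qed

section \<open>Averages of a nonnegative integrable function\<close>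

text \<open>A locale, so that its facts can also be instantiated at truncations of \<open>g\<close>
  and at power functions.\<close>

locale nonneg_integrable =
  fixes g :: "real \<Rightarrow> real"
  assumes g: "nonneg_integrable_01 g"
begin

lemma g_nonneg: "t \<in> {0..1} \<Longrightarrow> 0 \<le> g t"
  using g by (simp add: nonneg_integrable_01_def)

lemma absolutely_integrable_g: "0 \<le> a \<Longrightarrow> b \<le> 1 \<Longrightarrow> g absolutely_integrable_on {a..b}"
  using g by (auto simp: nonneg_integrable_01_def intro: set_integrable_subset)

lemma integrable_g: "0 \<le> a \<Longrightarrow> b \<le> 1 \<Longrightarrow> g integrable_on {a..b}"
  using absolutely_integrable_g set_lebesgue_integral_eq_integral(1) by blast

lemma LINT_g: "0 \<le> a \<Longrightarrow> b \<le> 1 \<Longrightarrow> (LINT t:{a..b}|lebesgue. g t) = integral {a..b} g"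
  by (simp add: set_lebesgue_integral_eq_integral absolutely_integrable_g)

lemma avg_eq: "t \<le> 1 \<Longrightarrow> avg g t = integral {0..t} g / t"
  by (simp add: avg_def LINT_g)

lemma integral_g_nonneg: "t \<le> 1 \<Longrightarrow> 0 \<le> integral {0..t} g"
  using integrable_g[of 0 t] g_nonneg by (intro integral_nonneg) auto

lemma integral_g_mono: "s \<le> t \<Longrightarrow> t \<le> 1 \<Longrightarrow> integral {0..s} g \<le> integral {0..t} g"
  using integrable_g g_nonneg by (intro integral_subset_le) auto

lemma avg_nonneg: "0 \<le> t \<Longrightarrow> t \<le> 1 \<Longrightarrow> 0 \<le> avg g t"
  by (simp add: avg_eq integral_g_nonneg)

lemma continuous_on_integral_g: "continuous_on {0..1} (\<lambda>t. integral {0..t} g)"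
  by (intro indefinite_integral_continuous_1 integrable_g) auto

lemma measurable_g: "g \<in> borel_measurable (lebesgue_on {0..1})"
  by (rule absolutely_integrable_imp_borel_measurable[OF absolutely_integrable_g]) auto

lemma measurable_avg: "avg g \<in> borel_measurable (lebesgue_on {0..1})"
proof -
  have "(\<lambda>t. 1 / t * integral {0..t} g) \<in> borel_measurable (lebesgue_on {0..1})"
    by (intro borel_measurable_times measurable_one_divide
        continuous_imp_measurable_on_sets_lebesgue[OF continuous_on_integral_g]) simp
  then show ?thesis
    by (rule measurable_cong[THEN iffD1, rotated]) (auto simp: avg_eq)
qed

text \<open>The integrand is the derivative of \<open>t * avg g t powr p\<close>. The point 0 is cut
  off, and the boundary term at \<open>a\<close> is dealt with separately.\<close>

lemma has_integral_hardy_identity: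
  assumes "1 < p" "0 < a" "a \<le> 1"
  shows "((\<lambda>t. p * (avg g t powr (p - 1) * g t) - (p - 1) * avg g t powr p) has_integral
    integral {0..1} g powr p - a * avg g a powr p) {a..1}"
proof -
  define G where "G = (\<lambda>t. integral {0..t} g)"
  define \<phi>\<^sub>1 where "\<phi>\<^sub>1 = (\<lambda>t. (1 - p) * t powr (- p) * G t powr p)"
  define \<phi>\<^sub>2 where "\<phi>\<^sub>2 = (\<lambda>t. p * t powr (1 - p) * G t powr (p - 1))"
  \<comment> \<open>At \<open>(t, G t)\<close> this is \<open>t * avg g t powr p\<close>, with the
    division by \<open>t\<close> absorbed into the first power.\<close>
  define \<phi> where "\<phi> = (\<lambda>z::real \<times> real. fst z powr (1 - p) * snd z powr p)"
  have G0: "0 \<le> G t" if "t \<le> 1" for t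
    using that by (simp add: G_def integral_g_nonneg)
  have Gc: "continuous_on {a..1} G"
    unfolding G_def using assms by (auto intro: continuous_on_subset[OF continuous_on_integral_g])
  have "((\<lambda>t. \<phi>\<^sub>1 t + \<phi>\<^sub>2 t * g t) has_integral \<phi> (1, G 1) - \<phi> (a, G a)) {a..1}"
  proof (rule has_integral_chain_rule_indefinite)
    show "G t = G a + integral {a..t} g" if "t \<in> {a..1}" for t
      using Henstock_Kurzweil_Integration.integral_combine[of 0 a t g] integrable_g[of 0 t] that assms
      by (simp add: G_def)
    show "(\<phi> has_derivative (\<lambda>(u, v). \<phi>\<^sub>1 t * u + \<phi>\<^sub>2 t * v)) (at (t, G t) within {a..1} \<times> G ` {a..1})"
      if t: "t \<in> {a..1}" for t
    proof -
      have 1: "((\<lambda>z. fst z powr (1 - p)) has_derivative (\<lambda>z. (1 - p) * t powr (- p) * fst z))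
          (at (t, G t) within {a..1} \<times> G ` {a..1})"
        using has_real_derivative_powr[of t "1 - p"] t assms
        by (intro has_derivative_compose[OF _ has_field_derivative_imp_has_derivative, of fst fst])
           (auto intro!: derivative_intros)
      \<comment> \<open>\<open>G t\<close> may be 0, hence the derivative within the nonnegative
        range of \<open>G\<close>.\<close>
      have 2: "((\<lambda>z. snd z powr p) has_derivative (\<lambda>z. p * G t powr (p - 1) * snd z))
          (at (t, G t) within {a..1} \<times> G ` {a..1})"
        using has_field_derivative_subset[OF has_real_derivative_powr_nonneg[OF \<open>1 < p\<close> G0], of t "G ` {a..1}"] t G0
        by (intro has_derivative_in_compose[OF _ has_derivative_subset[OF has_field_derivative_imp_has_derivative], of snd snd])
           (auto intro!: derivative_intros has_real_derivative_powr_nonneg[OF \<open>1 < p\<close> G0])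
      show ?thesis
        unfolding \<phi>_def
        by (rule has_derivative_eq_rhs[OF has_derivative_mult[OF 1 2]])
           (auto simp: \<phi>\<^sub>1_def \<phi>\<^sub>2_def fun_eq_iff algebra_simps)
    qed
    show "continuous_on {a..1} \<phi>\<^sub>1" "continuous_on {a..1} \<phi>\<^sub>2"
      unfolding \<phi>\<^sub>1_def \<phi>\<^sub>2_def using assms G0
      by (auto intro!: continuous_intros continuous_on_powr' Gc)
  qed (use assms g_nonneg in \<open>auto intro: absolutely_integrable_g\<close>)
  then have "((\<lambda>t. p * (avg g t powr (p - 1) * g t) - (p - 1) * avg g t powr p) has_integral
      \<phi> (1, G 1) - \<phi> (a, G a)) {a..1}"
  proof (rule has_integral_eq[rotated])
    show "\<phi>\<^sub>1 t + \<phi>\<^sub>2 t * g t = p * (avg g t powr (p - 1) * g t) - (p - 1) * avg g t powr p"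
      if "t \<in> {a..1}" for t
    proof -
      have "avg g t = G t / t"
        using that by (simp add: avg_eq G_def)
      then show ?thesis
        using that assms G0[of t] powr_minus_divide[of t "p - 1"]
        by (simp add: \<phi>\<^sub>1_def \<phi>\<^sub>2_def powr_divide powr_minus_divide algebra_simps)
          (simp add: diff_divide_distrib)
    qed
  qed
  moreover have "\<phi> (1, G 1) - \<phi> (a, G a) = integral {0..1} g powr p - a * avg g a powr p"
    using assms G0[of a]
    by (simp add: \<phi>_def avg_eq G_def[symmetric] powr_divide powr_diff) (simp add: G_def)
  ultimately show ?thesis
    by simp
qed

text \<open>Otherwise \<open>1 / t\<close> would be dominated by \<open>avg g t powr p / e\<close>
  near 0 and so be integrable. This yields some point \<open>a\<close> below each \<open>b\<close>,
  not a limit at 0; such points are enough for letting \<open>a\<close> shrink.\<close>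

lemma small_boundary_term:
  assumes fin: "(\<integral>\<^sup>+t\<in>{0..1}. ennreal (avg g t powr p) \<partial>lebesgue) < \<infinity>" and "0 < e" "0 < b"
  obtains a where "0 < a" "a < b" "a \<le> 1" "a * avg g a powr p < e"
proof -
  have "\<exists>a. 0 < a \<and> a < b \<and> a \<le> 1 \<and> a * avg g a powr p < e"
  proof (rule ccontr)
    assume "\<not> ?thesis"
    then have neg: "\<forall>a. 0 < a \<longrightarrow> a < b \<longrightarrow> a \<le> 1 \<longrightarrow> e \<le> a * avg g a powr p"
      by (auto simp: not_less)
    define c where "c = min 1 (b / 2)"
    have c: "0 < c" "c < b" "c \<le> 1"
      using \<open>0 < b\<close> by (auto simp: c_def)
    have "(\<lambda>t. avg g t powr p) absolutely_integrable_on {0..1}"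
      using fin by (intro set_nn_integral_lebesgue_eq_integral) (auto intro: powr_real_measurable measurable_avg)
    then have "(\<lambda>t. avg g t powr p) absolutely_integrable_on {0..c}"
      using c by (auto intro: set_integrable_subset)
    then have "(\<lambda>t. avg g t powr p / e) integrable_on {0..c}"
      by (intro integrable_on_divide set_lebesgue_integral_eq_integral(1))
    moreover have "\<bar>1 / t\<bar> \<le> avg g t powr p / e" if "t \<in> {0..c}" for t
    proof (cases "t = 0")
      case False
      then have "e \<le> t * avg g t powr p"
        using neg[rule_format, of t] that c by (auto simp: not_less)
      with False that \<open>0 < e\<close> show ?thesis by (simp add: field_simps)
    \<comment> \<open>At \<open>t = 0\<close> the left-hand side is 0, since
      \<open>1 / 0 = 0\<close>.\<close>
    qed (use \<open>0 < e\<close> in simp)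
    ultimately have "(\<lambda>t. 1 / t) integrable_on {0..c}"
      by (rule measurable_bounded_by_integrable_imp_integrable_real[OF measurable_one_divide]) auto
    then show False
      using not_integrable_inverse_from_0[OF c(1)] by contradiction
  qed
  then show ?thesis using that by blast
qed

end

section \<open>The pointwise inequality and the case of finite integrals\<close>

text \<open>Here \<open>x\<close> and \<open>y\<close> stand for the values of the average and of
  \<open>g\<close> at one point. The second part records equality: strict Bernoulli leaves only
  \<open>x = 0\<close> or \<open>z = 1\<close>, and \<open>k\<close> vanishes in both cases.\<close>

lemma hardy_pointwise:
  fixes p q x y :: real
  assumes pq: "1 < p" "1 \<le> q" and xy: "0 \<le> x" "0 \<le> y"
  defines "k \<equiv> p * (x powr (p - 1) * y) - (p - 1) * x powr p"
    and "l \<equiv> (p / (p - 1)) powr q * (x powr (p - q) * y powr q)"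
  shows "x powr p + q / (p - 1) * k \<le> l"
    and "1 < q \<Longrightarrow> x powr p + q / (p - 1) * k = l \<Longrightarrow> k = 0"
proof -
  \<comment> \<open>For \<open>x = 0\<close> division by zero gives \<open>z = 0\<close>; the
    identities below survive because 0 to any power is 0.\<close>
  define z where "z = p / (p - 1) * y / x"
  have z: "0 \<le> z" using pq xy by (simp add: z_def)
  have e1: "x powr p + q / (p - 1) * k = x powr p * (1 + q * (z - 1))"
    and e2: "l = x powr p * z powr q" and e3: "k = (p - 1) * (x powr p * (z - 1))"
  proof -
    show e2: "l = x powr p * z powr q"
    proof (cases "x = 0")
      case False
      have "z powr q = (p / (p - 1)) powr q * y powr q / x powr q"
        using pq xy powr_mult[of "p / (p - 1)" y q] powr_divide[of "p / (p - 1) * y" x q]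
        by (simp add: z_def)
      then show ?thesis
        using False xy by (simp add: l_def powr_diff)
    qed (simp add: l_def)
    show e3: "k = (p - 1) * (x powr p * (z - 1))"
      using pq xy by (cases "x = 0") (auto simp: k_def z_def powr_diff field_simps)
    show "x powr p + q / (p - 1) * k = x powr p * (1 + q * (z - 1))"
      using pq unfolding e3 by (simp add: field_simps)
  qed
  have bern: "1 + q * (z - 1) \<le> z powr q"
    using one_add_mult_less_powr[of q z] pq z by (cases "q = 1 \<or> z = 1") auto
  show "x powr p + q / (p - 1) * k \<le> l"
    unfolding e1 e2 by (intro mult_left_mono bern) auto
  show "k = 0" if "1 < q" "x powr p + q / (p - 1) * k = l"
  proof (cases "x = 0 \<or> z = 1")
    case False
    then have "x powr p * (1 + q * (z - 1)) < x powr p * z powr q"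
      using one_add_mult_less_powr[of q z] that z by (intro mult_strict_left_mono) auto
    then show ?thesis using that(2) e1 e2 by simp
  qed (use pq in \<open>auto simp: e3\<close>)
qed

text \<open>A nonnegative function with integral 0 vanishes almost everywhere, hence so does
  \<open>h\<close>. This transfers equality in the integrated inequality to the derivative
  \<open>k\<close>.\<close>

lemma integral_eq_0_imp_integral_eq_0:
  fixes f h :: "'a::euclidean_space \<Rightarrow> real"
  assumes "f integrable_on S" and "\<And>x. x \<in> S \<Longrightarrow> 0 \<le> f x" and "integral S f = 0"
    and "\<And>x. x \<in> S \<Longrightarrow> f x = 0 \<Longrightarrow> h x = 0"
  shows "(h has_integral 0) S"
proof -
  have f: "f absolutely_integrable_on S"
    using assms(1,2) by (rule nonnegative_absolutely_integrable_1)
  have "(LINT x|lebesgue. indicator S x *\<^sub>R f x) = 0"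
    using assms(3) set_lebesgue_integral_eq_integral(2)[OF f] by (simp add: set_lebesgue_integral_def)
  then have "AE x in lebesgue. indicator S x *\<^sub>R f x = 0"
    using f assms(2) unfolding set_integrable_def
    by (subst (asm) integral_nonneg_eq_0_iff_AE) (auto simp: indicator_def)
  then obtain N where N: "negligible N" "{x. indicator S x *\<^sub>R f x \<noteq> 0} \<subseteq> N"
    unfolding eventually_ae_filter_negligible by blast
  then show ?thesis
    by (intro has_integral_negligible[of N]) (use assms(4) in \<open>auto simp: indicator_def split: if_splits\<close>)
qed

context nonneg_integrable
begin

lemma measurable_lhs: "(\<lambda>t. avg g t powr p) \<in> borel_measurable (lebesgue_on {0..1})"
  by (intro powr_real_measurable measurable_avg) auto

lemma measurable_rhs: "(\<lambda>t. avg g t powr (p - q) * g t powr q) \<in> borel_measurable (lebesgue_on {0..1})"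
  by (intro borel_measurable_times powr_real_measurable measurable_avg measurable_g) auto

text \<open>With both integrals finite the claim concerns real numbers, and the pointwise inequality
  can be integrated over \<open>{a..1}\<close> with \<open>a\<close> shrinking to 0.\<close>

lemma hardy_finite:
  assumes pq: "1 < p" "1 \<le> q"
    and L: "(\<integral>\<^sup>+t\<in>{0..1}. ennreal (avg g t powr p) \<partial>lebesgue) < \<infinity>"
    and R: "(\<integral>\<^sup>+t\<in>{0..1}. ennreal (avg g t powr (p - q) * g t powr q) \<partial>lebesgue) < \<infinity>"
  defines "f \<equiv> integral {0..1} g"
    and "X \<equiv> integral {0..1} (\<lambda>t. avg g t powr p)"
    and "Y \<equiv> integral {0..1} (\<lambda>t. avg g t powr (p - q) * g t powr q)"
  shows "X \<le> (p / (p - 1)) powr q * Y - q / (p - 1) * f powr p"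
    and "1 < q \<Longrightarrow> 0 < f \<Longrightarrow> X < (p / (p - 1)) powr q * Y - q / (p - 1) * f powr p"
proof -
  define K where "K = (p / (p - 1)) powr q"
  define C where "C = q / (p - 1)"
  define x where "x = (\<lambda>t. avg g t powr p)"
  define y where "y = (\<lambda>t. avg g t powr (p - q) * g t powr q)"
  define k where "k = (\<lambda>t. p * (avg g t powr (p - 1) * g t) - (p - 1) * avg g t powr p)"
  \<comment> \<open>The defect in the pointwise inequality.\<close>
  define D where "D = (\<lambda>t. K * y t - x t - C * k t)"
  have C: "0 < C" using pq by (simp add: C_def)
  have K: "0 \<le> K" by (simp add: K_def)
  have xi: "x integrable_on {0..1}" and yi: "y integrable_on {0..1}"
    using set_nn_integral_lebesgue_eq_integral(1)[OF measurable_lhs _ _ L]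
      set_nn_integral_lebesgue_eq_integral(1)[OF measurable_rhs _ _ R]
    by (auto simp: x_def y_def intro!: set_lebesgue_integral_eq_integral)
  have X: "X = integral {0..1} x" and Y: "Y = integral {0..1} y"
    by (simp_all add: X_def Y_def x_def y_def)
  have D0: "0 \<le> D t" and Dk: "1 < q \<Longrightarrow> D t = 0 \<Longrightarrow> k t = 0" if "t \<in> {0..1}" for t
    using hardy_pointwise[OF pq, of "avg g t" "g t"] avg_nonneg[of t] g_nonneg[OF that] that
    by (auto simp: D_def k_def K_def C_def x_def y_def)
  have kI: "(k has_integral f powr p - a * x a) {a..1}" if "0 < a" "a \<le> 1" for a
    using has_integral_hardy_identity[OF \<open>1 < p\<close> that] by (simp add: k_def f_def x_def)
  have Di: "(D has_integral K * integral {a..1} y - integral {a..1} x - C * (f powr p - a * x a)) {a..1}"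
    if "0 < a" "a \<le> 1" for a
    unfolding D_def using that
    by (intro has_integral_diff has_integral_mult_right kI)
       (auto intro!: integrable_integral integrable_on_subinterval[OF xi] integrable_on_subinterval[OF yi])
  \<comment> \<open>The defect on a fixed \<open>{b..1}\<close> is bounded by the slack of the
    inequality. Taking \<open>b = 1\<close> gives the inequality itself; smaller \<open>b\<close>
    serve the case of equality.\<close>
  have main: "integral {b..1} D \<le> K * Y - X - C * f powr p" if b: "0 < b" "b \<le> 1" for b
  proof (rule field_le_epsilon)
    fix e :: real assume "0 < e"
    have "continuous_on {0..1} (\<lambda>t. integral {0..t} x)"
      by (intro indefinite_integral_continuous_1 xi)
    then have "\<exists>d>0. \<forall>t\<in>{0..1}. dist t 0 < d \<longrightarrow> dist (integral {0..t} x) (integral {0..0} x) < e / 2"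
      by (rule continuous_on_iff[THEN iffD1, rule_format]) (use \<open>0 < e\<close> in auto)
    then obtain d where "0 < d" and d: "\<And>t. t \<in> {0..1} \<Longrightarrow> \<bar>t\<bar> < d \<Longrightarrow> \<bar>integral {0..t} x\<bar> < e / 2"
      by (auto simp: dist_real_def)
    \<comment> \<open>Half of \<open>e\<close> pays for the boundary term
      \<open>C * (a * x a)\<close>, the other half for the integral of \<open>x\<close> over
      \<open>{0..a}\<close>.\<close>
    obtain a where a: "0 < a" "a < min b d" "a \<le> 1" "a * x a < e / (2 * C)"
      using small_boundary_term[OF L, of "e / (2 * C)" "min b d"] \<open>0 < e\<close> \<open>0 < d\<close> b C
      unfolding x_def by auto
    have "C * (a * x a) < e / 2"
      using a C by (simp add: field_simps)
    moreover have "\<bar>integral {0..a} x\<bar> < e / 2"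
      using d a by auto
    moreover have "integral {0..a} x + integral {a..1} x = X"
      unfolding X using a by (intro Henstock_Kurzweil_Integration.integral_combine xi) auto
    moreover have "K * integral {a..1} y \<le> K * Y"
      unfolding Y using a K g_nonneg
      by (intro mult_left_mono integral_subset_le yi integrable_on_subinterval[OF yi]) (auto simp: y_def)
    moreover have "integral {b..1} D \<le> integral {a..1} D"
      using Di[of a] Di[of b] a b D0 by (intro integral_subset_le) (auto intro: has_integral_integrable)
    moreover have "integral {a..1} D = K * integral {a..1} y - integral {a..1} x - C * f powr p + C * (a * x a)"
      using integral_unique[OF Di, of a] a by (simp add: algebra_simps)
    ultimately show "integral {b..1} D \<le> K * Y - X - C * f powr p + e"
      by linarith
  qed
  have "0 \<le> integral {1..1} D" by simp
  with main[of 1] show "X \<le> (p / (p - 1)) powr q * Y - q / (p - 1) * f powr p"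
    by (simp add: K_def C_def)
  show "X < (p / (p - 1)) powr q * Y - q / (p - 1) * f powr p" if "1 < q" "0 < f"
  proof (rule ccontr)
    assume "\<not> ?thesis"
    then have le: "integral {b..1} D \<le> 0" if "0 < b" "b \<le> 1" for b
      using main[OF that] unfolding K_def C_def by linarith
    \<comment> \<open>Without slack the defect is 0 almost everywhere, so \<open>k\<close> has
      integral 0 over \<open>{a..1}\<close> and the identity for \<open>k\<close> loses its
      left-hand side.\<close>
    have const: "a * x a = f powr p" if a: "0 < a" "a \<le> 1" for a
    proof -
      have "integral {a..1} D = 0"
        using le[OF a] integral_nonneg[OF has_integral_integrable[OF Di[OF a]]] D0 a by force
      then have "(k has_integral 0) {a..1}"
        using integral_eq_0_imp_integral_eq_0[OF has_integral_integrable[OF Di[OF a]], of k] D0 Dk a \<open>1 < q\<close> by auto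
      from has_integral_unique[OF this kI[OF a]] show ?thesis by simp
    qed
    have "0 < f powr p" using \<open>0 < f\<close> by simp
    then obtain a where "0 < a" "a \<le> 1" "a * x a < f powr p"
      using small_boundary_term[OF L _ zero_less_one] unfolding x_def by blast
    with const[of a] show False by simp
  qed
qed

section \<open>Truncation near 0 and the general inequality\<close>

context
  fixes c :: real and h :: "real \<Rightarrow> real"
  assumes c: "0 < c" "c \<le> 1"
  defines "h \<equiv> \<lambda>t. if t \<le> c then 0 else g t"
begin

lemma nonneg_integrable_truncation: "nonneg_integrable h"
proof
  have "set_integrable lebesgue {c<..1} g"
    using c by (intro set_integrable_subset[OF absolutely_integrable_g[of 0 1]]) auto
  moreover have "(\<lambda>t. indicator {0..1} t *\<^sub>R h t) = (\<lambda>t. indicator {c<..1} t *\<^sub>R g t)"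
    using c by (auto simp: h_def indicator_def)
  ultimately have "set_integrable lebesgue {0..1} h"
    by (simp only: set_integrable_def)
  then show "nonneg_integrable_01 h"
    using g_nonneg by (auto simp: nonneg_integrable_01_def h_def)
qed

text \<open>The maximum covers both sides of \<open>c\<close> in one formula, from which the limit
  as \<open>c\<close> tends to 0 can be read off.\<close>

lemma avg_truncation:
  assumes "0 \<le> t" "t \<le> 1"
  shows "avg h t = max 0 (integral {0..t} g - integral {0..c} g) / t"
proof -
  interpret h: nonneg_integrable h by (rule nonneg_integrable_truncation)
  have 0: "integral {0..s} h = 0" if "s \<le> c" for s
  proof -
    have "integral {0..s} h = integral {0..s} (\<lambda>_. 0)"
      using that by (intro integral_cong) (auto simp: h_def)
    then show ?thesis by simp
  qed
  have "integral {0..t} h = max 0 (integral {0..t} g - integral {0..c} g)"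
  proof (cases "t \<le> c")
    case True
    then show ?thesis using 0[of t] integral_g_mono[of t c] c by simp
  next
    case False
    have "integral {0..c} h + integral {c..t} h = integral {0..t} h"
      using False c assms by (intro Henstock_Kurzweil_Integration.integral_combine h.integrable_g) auto
    moreover have "integral {c..t} h = integral {c..t} g"
      by (rule integral_spike[of "{c}"]) (auto simp: h_def)
    moreover have "integral {0..c} g + integral {c..t} g = integral {0..t} g"
      using False c assms by (intro Henstock_Kurzweil_Integration.integral_combine integrable_g) auto
    ultimately show ?thesis
      using 0[of c] integral_g_mono[of c t] False assms by simp
  qed
  then show ?thesis using assms by (simp add: h.avg_eq)
qed

text \<open>The first bound compares the integrals on the right-hand side. The second does not
  depend on \<open>t\<close>, so the left-hand integral of the truncation is finite.\<close>

lemma avg_truncation_le: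
  assumes "0 \<le> t" "t \<le> 1"
  shows "avg h t \<le> avg g t" and "avg h t \<le> integral {0..1} g / c"
proof -
  have ge: "0 \<le> integral {0..c} g" "0 \<le> integral {0..t} g" "0 \<le> integral {0..1} g"
    using c assms by (auto intro: integral_g_nonneg)
  show "avg h t \<le> avg g t"
    using assms ge by (auto simp: avg_truncation avg_eq intro!: divide_right_mono)
  show "avg h t \<le> integral {0..1} g / c"
  proof (cases "t \<le> c")
    case True
    then show ?thesis
      using assms c ge integral_g_mono[of t c] by (simp add: avg_truncation)
  next
    case False
    then show ?thesis
      using assms c ge integral_g_mono[of t 1] by (auto simp: avg_truncation intro!: frac_le)
  qed
qed

end

text \<open>Truncating \<^term>\<open>g\<close> near \<open>0\<close> makes the left-hand side finite and can only decrease the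
  integral on the right, because \<open>p - q \<ge> 0\<close>.\<close>

lemma hardy_lhs_finite:
  assumes pq: "1 < p" "1 \<le> q" "q \<le> p"
    and R: "(\<integral>\<^sup>+t\<in>{0..1}. ennreal (avg g t powr (p - q) * g t powr q) \<partial>lebesgue) < \<infinity>"
  shows "(\<integral>\<^sup>+t\<in>{0..1}. ennreal (avg g t powr p) \<partial>lebesgue) < \<infinity>"
proof -
  define R where "R = (\<integral>\<^sup>+t\<in>{0..1}. ennreal (avg g t powr (p - q) * g t powr q) \<partial>lebesgue)"
  define K where "K = (p / (p - 1)) powr q"
  define c where "c = (\<lambda>n. 1 / real (Suc n))"
  define h where "h = (\<lambda>n t. if t \<le> c n then 0 else g t)"
  have c: "0 < c n" "c n \<le> 1" for n
    by (auto simp: c_def divide_simps)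
  have c_lim: "c \<longlonglongrightarrow> 0"
    unfolding c_def using LIMSEQ_inverse_real_of_nat by (simp add: inverse_eq_divide)
  have h_int: "nonneg_integrable (h n)" for n
    unfolding h_def by (rule nonneg_integrable_truncation[OF c])
  have avg_h: "avg (h n) t = max 0 (integral {0..t} g - integral {0..c n} g) / t"
    and avg_h_le: "avg (h n) t \<le> avg g t" "avg (h n) t \<le> integral {0..1} g / c n"
    if "0 \<le> t" "t \<le> 1" for t n
    unfolding h_def using avg_truncation[OF c that] avg_truncation_le[OF c that] by auto
  \<comment> \<open>The finite case applies to each truncation; dropping the nonnegative subtracted
    term leaves a bound independent of \<open>n\<close>.\<close>
  have bound: "(\<integral>\<^sup>+t\<in>{0..1}. ennreal (avg (h n) t powr p) \<partial>lebesgue) \<le> ennreal K * R" for n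
  proof -
    interpret h: nonneg_integrable "h n" by (rule h_int)
    have "(\<integral>\<^sup>+t\<in>{0..1}. ennreal (avg (h n) t powr p) \<partial>lebesgue)
        \<le> (\<integral>\<^sup>+t\<in>{0..1}. ennreal ((integral {0..1} g / c n) powr p) \<partial>(lebesgue :: real measure))"
      using pq avg_h_le(2)[of _ n] h.avg_nonneg
      by (intro nn_integral_mono) (auto simp: indicator_def intro!: ennreal_leI powr_mono2)
    also have "\<dots> < \<infinity>"
      by (simp add: nn_integral_cmult_indicator ennreal_mult_less_top)
    finally have L: "(\<integral>\<^sup>+t\<in>{0..1}. ennreal (avg (h n) t powr p) \<partial>lebesgue) < \<infinity>" .
    have R_le: "(\<integral>\<^sup>+t\<in>{0..1}. ennreal (avg (h n) t powr (p - q) * h n t powr q) \<partial>lebesgue) \<le> R"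
      unfolding R_def
      unfolding nn_integral_set_ennreal
    proof (intro nn_integral_mono ennreal_leI)
      fix t :: real
      show "avg (h n) t powr (p - q) * h n t powr q * indicator {0..1} t
          \<le> avg g t powr (p - q) * g t powr q * indicator {0..1} t"
      proof (cases "t \<in> {0..1}")
        case True
        then have "0 \<le> h n t" "h n t \<le> g t"
          using g_nonneg[OF True] by (auto simp: h_def)
        then show ?thesis
          using True pq avg_h_le(1)[of t n] h.avg_nonneg[of t]
          by (intro mult_right_mono mult_mono powr_mono2) auto
      qed simp
    qed
    also have "R < \<infinity>" using R by (simp add: R_def)
    finally have R': "(\<integral>\<^sup>+t\<in>{0..1}. ennreal (avg (h n) t powr (p - q) * h n t powr q) \<partial>lebesgue) < \<infinity>" .
    have "integral {0..1} (\<lambda>t. avg (h n) t powr p)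
        \<le> K * integral {0..1} (\<lambda>t. avg (h n) t powr (p - q) * h n t powr q)"
    proof -
      have "0 \<le> q / (p - 1) * integral {0..1} (h n) powr p"
        using pq by simp
      then show ?thesis
        using h.hardy_finite(1)[OF pq(1,2) L R'] unfolding K_def by linarith
    qed
    then have "ennreal (integral {0..1} (\<lambda>t. avg (h n) t powr p))
        \<le> ennreal K * ennreal (integral {0..1} (\<lambda>t. avg (h n) t powr (p - q) * h n t powr q))"
      by (simp add: ennreal_mult'[symmetric] K_def ennreal_leI)
    also have "\<dots> \<le> ennreal K * R"
      using set_nn_integral_lebesgue_eq_integral(2)[OF h.measurable_rhs _ _ R'] R_le
      by (intro mult_left_mono) auto
    finally show ?thesis
      using set_nn_integral_lebesgue_eq_integral(2)[OF h.measurable_lhs _ _ L] by simp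
  qed
  have lim: "(\<lambda>n. ennreal (avg (h n) t powr p)) \<longlonglongrightarrow> ennreal (avg g t powr p)" if t: "t \<in> {0..1}" for t
  proof -
    have "(\<lambda>n. integral {0..c n} g) \<longlonglongrightarrow> integral {0..0} g"
      using c less_imp_le[OF c(1)]
      by (intro continuous_on_tendsto_compose[OF continuous_on_integral_g c_lim] always_eventually) auto
    then have "(\<lambda>n. max 0 (integral {0..t} g - integral {0..c n} g) * (1 / t)) \<longlonglongrightarrow> max 0 (integral {0..t} g - 0) * (1 / t)"
      by (intro tendsto_intros) simp
    then have "(\<lambda>n. avg (h n) t) \<longlonglongrightarrow> avg g t"
      using t avg_h integral_g_nonneg[of t] by (simp add: avg_eq)
    then show ?thesis
      using pq t nonneg_integrable.avg_nonneg[OF h_int]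
      by (intro tendsto_ennrealI tendsto_powr' tendsto_const) auto
  qed
  have "(\<integral>\<^sup>+t\<in>{0..1}. ennreal (avg g t powr p) \<partial>lebesgue)
      = (\<integral>\<^sup>+t. liminf (\<lambda>n. ennreal (avg (h n) t powr p)) \<partial>lebesgue_on {0..1})"
    using lim_imp_Liminf[OF _ lim]
    by (auto simp: nn_integral_restrict_space[symmetric] intro!: nn_integral_cong)
  \<comment> \<open>Fatou's lemma carries the uniform bound over to \<open>g\<close>.\<close>
  also have "\<dots> \<le> liminf (\<lambda>n. \<integral>\<^sup>+t. ennreal (avg (h n) t powr p) \<partial>lebesgue_on {0..1})"
    using nonneg_integrable.measurable_lhs[OF h_int] by (intro nn_integral_liminf) auto
  also have "\<dots> \<le> ennreal K * R"
    using bound by (intro Liminf_le) (auto simp: nn_integral_restrict_space)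
  also have "\<dots> < \<infinity>"
    using R by (simp add: R_def ennreal_mult_less_top)
  finally show ?thesis .
qed

text \<open>If the integral on the right is infinite, so is the right-hand side, because its
  coefficient is positive. Otherwise the left-hand side is finite too, by truncation, and the
  real-valued version applies.\<close>

lemma hardy_inequality:
  assumes pq: "1 < p" "1 \<le> q" "q \<le> p"
  defines "f \<equiv> integral {0..1} g"
  shows "hardy_lhs p g \<le> hardy_rhs ((p / (p - 1)) powr q) (q / (p - 1)) p q f g"
    and "1 < q \<Longrightarrow> 0 < f \<Longrightarrow> hardy_lhs p g < \<infinity> \<Longrightarrow>
      hardy_lhs p g < hardy_rhs ((p / (p - 1)) powr q) (q / (p - 1)) p q f g"
proof -
  define R where "R = (\<integral>\<^sup>+t\<in>{0..1}. ennreal (avg g t powr (p - q) * g t powr q) \<partial>lebesgue)"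
  define Y where "Y = integral {0..1} (\<lambda>t. avg g t powr (p - q) * g t powr q)"
  define X where "X = integral {0..1} (\<lambda>t. avg g t powr p)"
  have K: "0 < (p / (p - 1)) powr q" using pq by simp
  have inf: "hardy_rhs ((p / (p - 1)) powr q) (q / (p - 1)) p q f g = \<infinity>" if "R = \<infinity>"
    using that K unfolding hardy_rhs_def R_def[symmetric] by simp
  have fin: "hardy_lhs p g = ereal X"
    "hardy_rhs ((p / (p - 1)) powr q) (q / (p - 1)) p q f g =
      ereal ((p / (p - 1)) powr q * Y - q / (p - 1) * f powr p)"
    and L: "(\<integral>\<^sup>+t\<in>{0..1}. ennreal (avg g t powr p) \<partial>lebesgue) < \<infinity>"
    if "R < \<infinity>"
  proof -
    note R = that[unfolded R_def]
    show L: "(\<integral>\<^sup>+t\<in>{0..1}. ennreal (avg g t powr p) \<partial>lebesgue) < \<infinity>"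
      by (rule hardy_lhs_finite[OF pq R])
    have "0 \<le> X" "0 \<le> Y"
      using set_lebesgue_integral_eq_integral(1)[OF set_nn_integral_lebesgue_eq_integral(1)[OF measurable_lhs _ _ L]]
        set_lebesgue_integral_eq_integral(1)[OF set_nn_integral_lebesgue_eq_integral(1)[OF measurable_rhs _ _ R]]
      by (auto simp: X_def Y_def intro!: integral_nonneg)
    then show "hardy_lhs p g = ereal X"
      "hardy_rhs ((p / (p - 1)) powr q) (q / (p - 1)) p q f g =
        ereal ((p / (p - 1)) powr q * Y - q / (p - 1) * f powr p)"
      using set_nn_integral_lebesgue_eq_integral(2)[OF measurable_lhs _ _ L]
        set_nn_integral_lebesgue_eq_integral(2)[OF measurable_rhs _ _ R]
      by (simp_all add: hardy_lhs_def hardy_rhs_def X_def Y_def)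
  qed
  have R: "R = \<infinity> \<or> R < \<infinity>"
    using top.not_eq_extremum[of R] by auto
  then show "hardy_lhs p g \<le> hardy_rhs ((p / (p - 1)) powr q) (q / (p - 1)) p q f g"
    using inf fin hardy_finite(1)[OF pq(1,2) L]
    by (auto simp: R_def X_def Y_def f_def)
  show "hardy_lhs p g < hardy_rhs ((p / (p - 1)) powr q) (q / (p - 1)) p q f g"
    if "1 < q" "0 < f" "hardy_lhs p g < \<infinity>"
    using R inf fin hardy_finite(2)[OF pq(1,2) L] that
    by (auto simp: R_def X_def Y_def f_def)
qed

end

section \<open>Sharpness of the two constants\<close>

text \<open>The average of this \<open>g\<close> is \<open>g t / (1 - \<alpha>)\<close> for
  \<open>t\<close> in \<open>{0..1}\<close>, so both integrands are multiples of
  \<open>t powr (- \<alpha> * p)\<close>, whose integral \<open>1 / (1 - \<alpha> * p)\<close> blows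
  up as \<alpha> increases to \<open>1 / p\<close>. The factor \<open>f * (1 - \<alpha>)\<close>
  normalises the integral of \<open>g\<close>.\<close>

lemma hardy_power_function:
  fixes p q f \<alpha> :: real
  assumes pq: "1 < p" "1 \<le> q" and "0 < f" and \<alpha>: "0 < \<alpha>" "\<alpha> * p < 1"
  defines "g \<equiv> \<lambda>t. f * (1 - \<alpha>) * t powr (- \<alpha>)"
  shows "nonneg_integrable_01 g" and "(LINT t:{0..1}|lebesgue. g t) = f"
    and "hardy_lhs p g = ereal (f powr p / (1 - \<alpha> * p))"
    and "hardy_rhs K C p q f g = ereal (K * ((1 - \<alpha>) powr q * f powr p / (1 - \<alpha> * p)) - C * f powr p)"
proof -
  have \<alpha>1: "\<alpha> < 1"
    using \<alpha> pq by (smt (verit) mult_less_cancel_left2)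
  have int: "(g has_integral f * t powr (1 - \<alpha>)) {0..t}" if "0 \<le> t" for t
    using has_integral_mult_right[OF has_integral_powr_from_0[of "- \<alpha>" t], of "f * (1 - \<alpha>)"] \<alpha>1 that
    by (simp add: g_def add.commute)
  have g0: "0 \<le> g t" for t
    using \<alpha>1 \<open>0 < f\<close> by (simp add: g_def)
  show g: "nonneg_integrable_01 g"
    unfolding nonneg_integrable_01_def
    using g0 int[of 1] by (auto intro!: nonnegative_absolutely_integrable_1)
  interpret nonneg_integrable g by unfold_locales (rule g)
  show "(LINT t:{0..1}|lebesgue. g t) = f"
    using int[of 1] by (simp add: LINT_g integral_unique)
  have avg: "avg g t = f * t powr (- \<alpha>)" if "t \<in> {0..1}" for t
    using that int[of t] by (simp add: avg_eq integral_unique powr_diff powr_minus_divide)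
  have pw: "((\<lambda>t. c * t powr (- \<alpha> * p)) has_integral c / (1 - \<alpha> * p)) {0..1}" for c
    using has_integral_mult_right[OF has_integral_powr_from_0[of "- \<alpha> * p" 1], of c] \<alpha>
    by (simp add: add.commute)
  have lhs: "avg g t powr p = f powr p * t powr (- \<alpha> * p)" if "t \<in> {0..1}" for t
    using that \<open>0 < f\<close> by (simp add: avg powr_mult powr_powr)
  have rhs: "avg g t powr (p - q) * g t powr q = (1 - \<alpha>) powr q * f powr p * t powr (- \<alpha> * p)"
    if "t \<in> {0..1}" for t
  proof (cases "t = 0")
    case False
    then have t: "0 < t" using that by simp
    have "g t = avg g t * (1 - \<alpha>)"
      unfolding avg[OF that] by (simp add: g_def)
    then have "avg g t powr (p - q) * g t powr q = avg g t powr (p - q) * (avg g t powr q * (1 - \<alpha>) powr q)"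
      by (metis powr_mult)
    also have "\<dots> = avg g t powr p * (1 - \<alpha>) powr q"
      by (simp add: mult.assoc[symmetric] powr_add[symmetric])
    finally show ?thesis
      using lhs[OF that] by simp
  qed (simp add: g_def)
  have "((\<lambda>t. avg g t powr p) has_integral f powr p / (1 - \<alpha> * p)) {0..1}"
    by (rule has_integral_eq[OF _ pw]) (simp add: lhs)
  from has_integral_imp_set_nn_integral_lebesgue[OF this]
  show "hardy_lhs p g = ereal (f powr p / (1 - \<alpha> * p))"
    using \<alpha> by (simp add: hardy_lhs_def)
  have "((\<lambda>t. avg g t powr (p - q) * g t powr q) has_integral (1 - \<alpha>) powr q * f powr p / (1 - \<alpha> * p)) {0..1}"
    by (rule has_integral_eq[OF _ pw]) (simp add: rhs)
  from has_integral_imp_set_nn_integral_lebesgue[OF this]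
  show "hardy_rhs K C p q f g = ereal (K * ((1 - \<alpha>) powr q * f powr p / (1 - \<alpha> * p)) - C * f powr p)"
    using \<alpha> by (simp add: hardy_rhs_def)
qed

text \<open>For the power functions it is enough that \<open>K * (1 - \<alpha>) powr q < 1\<close>,
  since the subtracted term only helps. This holds for \<alpha> close to \<open>1 / p\<close>,
  because the limit \<open>K * (1 - 1 / p) powr q\<close> is below 1.\<close>

lemma hardy_constant_sharp:
  fixes p q K :: real
  assumes pq: "1 < p" "1 \<le> q" and K: "K < (p / (p - 1)) powr q"
  shows "\<exists>g. nonneg_integrable_01 g \<and> (LINT t:{0..1}|lebesgue. g t) = 1 \<and>
    \<not> hardy_lhs p g \<le> hardy_rhs K (q / (p - 1)) p q 1 g"
proof -
  have "((\<lambda>\<alpha>. K * (1 - \<alpha>) powr q) \<longlongrightarrow> K * (1 - 1 / p) powr q) (at_left (1 / p))"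
    using pq by (intro tendsto_intros) auto
  moreover have "K * (1 - 1 / p) powr q < 1"
  proof -
    have "K * (1 - 1 / p) powr q < (p / (p - 1)) powr q * (1 - 1 / p) powr q"
      using K pq by (intro mult_strict_right_mono) auto
    also have "\<dots> = (p / (p - 1) * (1 - 1 / p)) powr q"
      using pq by (subst powr_mult) auto
    also have "p / (p - 1) * (1 - 1 / p) = 1"
      using pq by (simp add: field_simps)
    finally show ?thesis by simp
  qed
  ultimately have "\<forall>\<^sub>F \<alpha> in at_left (1 / p). K * (1 - \<alpha>) powr q < 1"
    by (rule order_tendstoD)
  moreover have "\<forall>\<^sub>F \<alpha> in at_left (1 / p). \<alpha> \<in> {0<..<1 / p}"
    using pq by (intro eventually_at_leftI[of 0]) auto
  ultimately have "\<forall>\<^sub>F \<alpha> in at_left (1 / p). K * (1 - \<alpha>) powr q < 1 \<and> \<alpha> \<in> {0<..<1 / p}"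
    by (rule eventually_conj)
  then obtain \<alpha> where \<alpha>: "K * (1 - \<alpha>) powr q < 1" "0 < \<alpha>" "\<alpha> * p < 1"
    using eventually_happens'[of "at_left (1 / p)"] pq by (fastforce simp: field_simps)
  note ex = hardy_power_function[OF pq zero_less_one \<alpha>(2,3)]
  have "K * (1 - \<alpha>) powr q / (1 - \<alpha> * p) < 1 / (1 - \<alpha> * p)"
    using \<alpha> by (intro divide_strict_right_mono) auto
  moreover have "0 < q / (p - 1)" using pq by simp
  ultimately have "\<not> 1 / (1 - \<alpha> * p) \<le> K * ((1 - \<alpha>) powr q / (1 - \<alpha> * p)) - q / (p - 1)"
    by simp
  then show ?thesis
    using ex by (intro exI conjI) (rule ex(1), rule ex(2), simp)
qed

text \<open>On the power functions the factor \<open>f powr p\<close> cancels, and failure means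
  \<open>(\<psi> \<alpha> - 1) / (1 - \<alpha> * p) < C\<close>. As
  \<open>\<psi> (1 / p) = 1\<close>, the left side is the difference quotient of \<psi> at
  \<open>1 / p\<close> divided by \<open>- p\<close>, so it tends to
  \<open>q / (p - 1)\<close>.\<close>

lemma hardy_subtracted_constant_sharp:
  fixes p q f C :: real
  assumes pq: "1 < p" "1 \<le> q" and "0 < f" and C: "q / (p - 1) < C"
  shows "\<exists>g. nonneg_integrable_01 g \<and> (LINT t:{0..1}|lebesgue. g t) = f \<and>
    \<not> hardy_lhs p g \<le> hardy_rhs ((p / (p - 1)) powr q) C p q f g"
proof -
  define \<psi> where "\<psi> = (\<lambda>\<alpha>. (p / (p - 1)) powr q * (1 - \<alpha>) powr q)"
  have \<psi>: "\<psi> \<alpha> = (p / (p - 1) * (1 - \<alpha>)) powr q" if "\<alpha> \<le> 1" for \<alpha>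
    using pq that unfolding \<psi>_def by (subst powr_mult) auto
  have one: "p / (p - 1) * (1 - 1 / p) = 1"
    using pq by (simp add: field_simps)
  have \<psi>1: "\<psi> (1 / p) = 1"
    using pq one \<psi>[of "1 / p"] by simp
  have "((\<lambda>\<alpha>. (1 - \<alpha>) powr q) has_real_derivative q * (1 - 1 / p) powr (q - 1) * (0 - 1)) (at (1 / p))"
    using pq by (intro DERIV_chain'[where g = "\<lambda>x. x powr q"] has_real_derivative_powr)
      (auto intro!: derivative_eq_intros)
  then have "(\<psi> has_real_derivative (p / (p - 1)) powr q * (q * (1 - 1 / p) powr (q - 1) * (0 - 1))) (at (1 / p))"
    unfolding \<psi>_def by (rule DERIV_cmult)
  also have "(p / (p - 1)) powr q * (q * (1 - 1 / p) powr (q - 1) * (0 - 1))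
      = - q * (\<psi> (1 / p) / (1 - 1 / p))"
    using pq by (simp add: \<psi>_def powr_diff)
  also have "\<dots> = - q * p / (p - 1)"
    unfolding \<psi>1 using pq by (simp add: field_simps)
  finally have "((\<lambda>\<alpha>. (\<psi> \<alpha> - \<psi> (1 / p)) / (\<alpha> - 1 / p)) \<longlongrightarrow> - q * p / (p - 1)) (at_left (1 / p))"
    unfolding has_field_derivative_iff by (rule filterlim_mono) (auto simp: at_le)
  moreover have "- p * C < - q * p / (p - 1)"
    using mult_strict_left_mono[OF C, of p] pq by (simp add: mult.commute)
  ultimately have "\<forall>\<^sub>F \<alpha> in at_left (1 / p). - p * C < (\<psi> \<alpha> - \<psi> (1 / p)) / (\<alpha> - 1 / p)"
    by (rule order_tendstoD)
  moreover have "\<forall>\<^sub>F \<alpha> in at_left (1 / p). \<alpha> \<in> {0<..<1 / p}"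
    using pq by (intro eventually_at_leftI[of 0]) auto
  ultimately have "\<forall>\<^sub>F \<alpha> in at_left (1 / p).
      - p * C < (\<psi> \<alpha> - \<psi> (1 / p)) / (\<alpha> - 1 / p) \<and> \<alpha> \<in> {0<..<1 / p}"
    by (rule eventually_conj)
  then obtain \<alpha> where "- p * C < (\<psi> \<alpha> - \<psi> (1 / p)) / (\<alpha> - 1 / p)" "0 < \<alpha>" "\<alpha> < 1 / p"
    using eventually_happens'[of "at_left (1 / p)"] by fastforce
  \<comment> \<open>Multiplication by the negative number \<open>\<alpha> - 1 / p\<close> reverses
    the inequality.\<close>
  then have "\<psi> \<alpha> - 1 < - p * C * (\<alpha> - 1 / p)" and \<alpha>: "0 < \<alpha>" "\<alpha> * p < 1"
    using pq by (auto simp: \<psi>1 neg_less_divide_eq field_simps)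
  then have "\<psi> \<alpha> - 1 < C * (1 - \<alpha> * p)"
    using pq by (simp add: algebra_simps)
  then have "(\<psi> \<alpha> - 1) / (1 - \<alpha> * p) < C"
    using \<alpha> by (simp add: pos_divide_less_eq)
  then have "\<psi> \<alpha> / (1 - \<alpha> * p) - C < 1 / (1 - \<alpha> * p)"
    by (simp add: diff_divide_distrib)
  then have "f powr p * (\<psi> \<alpha> / (1 - \<alpha> * p) - C) < f powr p * (1 / (1 - \<alpha> * p))"
    using \<open>0 < f\<close> by (intro mult_strict_left_mono) auto
  then have "\<not> f powr p / (1 - \<alpha> * p)
      \<le> (p / (p - 1)) powr q * ((1 - \<alpha>) powr q * f powr p / (1 - \<alpha> * p)) - C * f powr p"
    by (simp add: \<psi>_def right_diff_distrib mult_ac)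
  then show ?thesis
    using hardy_power_function[OF pq \<open>0 < f\<close> \<alpha>]
    by (intro exI conjI) (rule hardy_power_function[OF pq \<open>0 < f\<close> \<alpha>], rule hardy_power_function(2)[OF pq \<open>0 < f\<close> \<alpha>], simp)
qed

theorem theorem1:
  fixes p q :: real
  assumes "1 < p" and "1 \<le> q" and "q \<le> p"
  shows
    "(\<forall>g f. nonneg_integrable_01 g \<and> (LINT t:{0..1}|lebesgue. g t) = f \<longrightarrow>
        hardy_lhs p g \<le> hardy_rhs ((p / (p - 1)) powr q) (q / (p - 1)) p q f g \<and>
        (1 < q \<and> 0 < f \<and> hardy_lhs p g < \<infinity> \<longrightarrow>
          hardy_lhs p g < hardy_rhs ((p / (p - 1)) powr q) (q / (p - 1)) p q f g))
   \<and> (\<forall>K. K < (p / (p - 1)) powr q \<longrightarrow>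
        (\<exists>g f. nonneg_integrable_01 g \<and> (LINT t:{0..1}|lebesgue. g t) = f \<and>
          \<not> hardy_lhs p g \<le> hardy_rhs K (q / (p - 1)) p q f g))
   \<and> (\<forall>f C. 0 < f \<and> q / (p - 1) < C \<longrightarrow>
        (\<exists>g. nonneg_integrable_01 g \<and> (LINT t:{0..1}|lebesgue. g t) = f \<and>
          \<not> hardy_lhs p g \<le> hardy_rhs ((p / (p - 1)) powr q) C p q f g))"
proof (intro conjI allI impI; (elim conjE)?)
  fix g f
  assume "nonneg_integrable_01 g" and f: "(LINT t:{0..1}|lebesgue. g t) = f"
  then interpret nonneg_integrable g by unfold_locales
  have f': "f = integral {0..1} g"
    using f LINT_g[of 0 1] by simp
  show "hardy_lhs p g \<le> hardy_rhs ((p / (p - 1)) powr q) (q / (p - 1)) p q f g"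
    unfolding f' by (rule hardy_inequality(1)[OF assms])
  show "hardy_lhs p g < hardy_rhs ((p / (p - 1)) powr q) (q / (p - 1)) p q f g"
    if "1 < q" "0 < f" "hardy_lhs p g < \<infinity>"
    using that unfolding f' by (rule hardy_inequality(2)[OF assms])
next
  show "\<exists>g f. nonneg_integrable_01 g \<and> (LINT t:{0..1}|lebesgue. g t) = f \<and>
          \<not> hardy_lhs p g \<le> hardy_rhs K (q / (p - 1)) p q f g"
    if "K < (p / (p - 1)) powr q" for K
    using hardy_constant_sharp[OF assms(1,2) that] by blast
next
  show "\<exists>g. nonneg_integrable_01 g \<and> (LINT t:{0..1}|lebesgue. g t) = f \<and>
          \<not> hardy_lhs p g \<le> hardy_rhs ((p / (p - 1)) powr q) C p q f g"
    if "0 < f" "q / (p - 1) < C" for f C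
    by (rule hardy_subtracted_constant_sharp[OF assms(1,2) that])
qed

end
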